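(* A strongly regular graph with parameters $(v,k,\lambda,\mu)$ yields a binary even LCD code if and only if (i) $k\equiv 0\pmod 2$; (ii) $\lambda\equiv 1\pmod 2$; and (iii) $\mu\equiv 0\pmod 2$.
   Context: A strongly regular graph with parameters $(v,k,\lambda,\mu)$ is a simple $k$-regular graph on $v$ vertices in which any two adjacent vertices have exactly $\lambda$ common neighbours and any two distinct non-adjacent vertices have exactly $\mu$ common neighbours. Conventions: the graph has at least one edge, and the complete graph $K_n$ is assigned the parameters $(n,n-1,n-2,0)$. A binary code of length $n$ is a linear subspace $C\subseteq\mathbb{F}_2^n$ (the zero code is allowed). Its dual $C^\perp$ is taken with respect to $\langle x,y\rangle=\sum_i x_iy_i$. $C$ is LCD (linear complementary dual) if $C\cap C^\perp=\{0\}$, equivalently $\mathbb{F}_2^n=C\oplus C^\perp$. $C$ is even if every codeword has even Hamming weight. For an LCD code $C$, the orthogonal projector $\Pi_C$ is the unique $n\times n$ matrix over $\mathbb{F}_2$ with $v\Pi_C=v$ for all row vectors $v\in C$ and $v\Pi_C=0$ for all $v\in C^\perp$. A finite simple graph on $n$ (ordered) vertices with adjacency matrix $A$ is said to yield a binary even LCD code if $A$, read over $\mathbb{F}_2$, equals $\Pi_C$ for some binary even LCD code $C$ of length $n$; this $C$ (which is the row span of $A$ over $\mathbb{F}_2$) is the code yielded by the graph. *)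

theory Defs
  imports
    "Graph_Theory.Digraph"
    "Jordan_Normal_Form.VS_Connect"
    "HOL-Library.Z2"
    "HOL-Number_Theory.Cong"
begin

text \<open>
  A finite simple graph is a \<^locale>\<open>graph\<close> in the sense of the Graph_Theory entry: a finite
  symmetric digraph without loops and without parallel arcs, each edge being represented by a pair
  of opposite arcs. In particular, the out-degree is the degree.
\<close>

definition common_neighbours :: "('a, 'b) pre_digraph \<Rightarrow> 'a \<Rightarrow> 'a \<Rightarrow> 'a set" where
  "common_neighbours G x y = {z \<in> verts G. x \<rightarrow>\<^bsub>G\<^esub> z \<and> y \<rightarrow>\<^bsub>G\<^esub> z}"

definition complete_graph :: "('a, 'b) pre_digraph \<Rightarrow> bool" where
  "complete_graph G \<longleftrightarrow> (\<forall>x \<in> verts G. \<forall>y \<in> verts G. x \<noteq> y \<longrightarrow> x \<rightarrow>\<^bsub>G\<^esub> y)"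

text \<open>
  In a complete graph the condition on non-adjacent pairs is vacuous, so the conventional value
  \<open>\<mu> = 0\<close> is imposed. The remaining conventional parameters \<open>k = n - 1\<close> and \<open>\<lambda> = n - 2\<close>
  are then forced by the other clauses because there is an edge.
\<close>

definition strongly_regular_graph ::
    "('a, 'b) pre_digraph \<Rightarrow> nat \<Rightarrow> nat \<Rightarrow> nat \<Rightarrow> nat \<Rightarrow> bool" where
  "strongly_regular_graph G v k l m \<longleftrightarrow>
     graph G \<and> arcs G \<noteq> {} \<and> card (verts G) = v \<and>
     (\<forall>x \<in> verts G. out_degree G x = k) \<and>
     (\<forall>x \<in> verts G. \<forall>y \<in> verts G. x \<rightarrow>\<^bsub>G\<^esub> y \<longrightarrow> card (common_neighbours G x y) = l) \<and>
     (\<forall>x \<in> verts G. \<forall>y \<in> verts G.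
        x \<noteq> y \<and> \<not> x \<rightarrow>\<^bsub>G\<^esub> y \<longrightarrow> card (common_neighbours G x y) = m) \<and>
     (complete_graph G \<longrightarrow> m = 0)"

definition binary_code :: "nat \<Rightarrow> bit vec set \<Rightarrow> bool" where
  "binary_code n C \<longleftrightarrow> VectorSpace.subspace class_ring C (module_vec TYPE(bit) n)"

abbreviation dual_code :: "nat \<Rightarrow> bit vec set \<Rightarrow> bit vec set" where
  "dual_code n C \<equiv> vec_module.orthogonal_complement n C"

definition LCD_code :: "nat \<Rightarrow> bit vec set \<Rightarrow> bool" where
  "LCD_code n C \<longleftrightarrow> binary_code n C \<and> C \<inter> dual_code n C = {0\<^sub>v n}"

definition hamming_weight :: "bit vec \<Rightarrow> nat" where
  "hamming_weight x = card {i. i < dim_vec x \<and> x $ i \<noteq> 0}"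

definition even_code :: "bit vec set \<Rightarrow> bool" where
  "even_code C \<longleftrightarrow> (\<forall>x \<in> C. even (hamming_weight x))"

definition row_vec_mult :: "'a::semiring_0 vec \<Rightarrow> 'a mat \<Rightarrow> 'a vec" (infixl \<open>\<^sub>v*\<close> 70) where
  "x \<^sub>v* P = vec (dim_col P) (\<lambda>j. x \<bullet> col P j)"

definition is_orthogonal_projector :: "nat \<Rightarrow> bit vec set \<Rightarrow> bit mat \<Rightarrow> bool" where
  "is_orthogonal_projector n C P \<longleftrightarrow>
     P \<in> carrier_mat n n \<and>
     (\<forall>x \<in> C. x \<^sub>v* P = x) \<and> (\<forall>x \<in> dual_code n C. x \<^sub>v* P = 0\<^sub>v n)"

text \<open>
  The description is proper for LCD codes \<open>C\<close>, since then the whole space is the direct sum of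
  \<open>C\<close> and its dual; the projector is only used for such codes.
\<close>

definition orthogonal_projector :: "nat \<Rightarrow> bit vec set \<Rightarrow> bit mat" where
  "orthogonal_projector n C = (THE P. is_orthogonal_projector n C P)"

text \<open>The list \<open>vs\<close> enumerates the vertices without repetition, which fixes their order.\<close>

definition adjacency_matrix :: "('a, 'b) pre_digraph \<Rightarrow> 'a list \<Rightarrow> 'c::zero_neq_one mat" where
  "adjacency_matrix G vs =
     mat (length vs) (length vs) (\<lambda>(i, j). if vs ! i \<rightarrow>\<^bsub>G\<^esub> vs ! j then 1 else 0)"

definition yields_even_LCD_code :: "('a, 'b) pre_digraph \<Rightarrow> 'a list \<Rightarrow> bool" where
  "yields_even_LCD_code G vs \<longleftrightarrow>
     (\<exists>C. LCD_code (length vs) C \<and> even_code C \<and>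
        (adjacency_matrix G vs :: bit mat) = orthogonal_projector (length vs) C)"

end

theory Submission
  imports Defs
begin

text \<open>
  A symmetric matrix over the two-element field with zero diagonal is the orthogonal projector of
  an even LCD code iff it is idempotent; here the nontrivial ingredient is that an LCD code and its
  dual span the whole space, which follows from biduality. For an adjacency matrix \<open>A\<close>, the
  entries of \<open>A\<^sup>2\<close> count common neighbours modulo 2, so \<open>A\<^sup>2 = A\<close> says that \<open>k\<close> is even
  (diagonal entries), \<open>\<lambda>\<close> is odd (edges) and \<open>\<mu>\<close> is even (non-edges).
\<close>

section \<open>Binary codes and biduality\<close>

lemma of_nat_bit_eq_0_iff: "(of_nat k :: bit) = 0 \<longleftrightarrow> even k"
  by (induction k) auto

text \<open>Finiteness is what guarantees a maximal element among the codes that avoid a given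
  vector; no appeal to Zorn's lemma is made.\<close>

lemma finite_carrier_vec_bit: "finite (carrier_vec n :: bit vec set)"
proof -
  have U: "(UNIV :: bit set) = {0, 1}"
    using bit_not_zero_iff by blast
  have "finite {xs :: bit list. set xs \<subseteq> UNIV \<and> length xs = n}"
    by (rule finite_lists_length_eq) (simp add: U)
  moreover have "(carrier_vec n :: bit vec set) \<subseteq> vec_of_list ` {xs. set xs \<subseteq> UNIV \<and> length xs = n}"
  proof
    fix x :: "bit vec"
    assume "x \<in> carrier_vec n"
    then have "x = vec_of_list (list_of_vec x)" "length (list_of_vec x) = n"
      by (auto simp: vec_list)
    then show "x \<in> vec_of_list ` {xs. set xs \<subseteq> UNIV \<and> length xs = n}"
      by blast
  qed
  ultimately show ?thesis
    by (rule finite_surj)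
qed

lemma add_self_bit_vec: "x \<in> carrier_vec n \<Longrightarrow> x + x = (0\<^sub>v n :: bit vec)"
  by (intro eq_vecI) auto

lemma add_cancel_bit_vec:
  fixes a b :: "bit vec"
  assumes "a \<in> carrier_vec n" "b \<in> carrier_vec n"
  shows "a + (a + b) = b" "a + b + b = a"
  using assms assoc_add_vec[of a n a b] assoc_add_vec[of a n b b] by (simp_all add: add_self_bit_vec)

lemma add_exchange_vec:
  fixes a b c d :: "'a::comm_monoid_add vec"
  assumes "a \<in> carrier_vec n" "b \<in> carrier_vec n" "c \<in> carrier_vec n" "d \<in> carrier_vec n"
  shows "(a + b) + (c + d) = (a + c) + (b + d)"
  using assms by (intro eq_vecI) (simp_all add: ac_simps)

text \<open>The only scalars are 0 and 1, so a set that contains the zero vector and is closed under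
  addition is automatically closed under scaling.\<close>

lemma binary_code_iff:
  "binary_code n C \<longleftrightarrow>
     C \<subseteq> carrier_vec n \<and> 0\<^sub>v n \<in> C \<and> (\<forall>x\<in>C. \<forall>y\<in>C. x + y \<in> C)"
proof -
  have "c \<cdot>\<^sub>v x \<in> C" if "C \<subseteq> carrier_vec n" "0\<^sub>v n \<in> C" "x \<in> C" for c :: bit and x
  proof (cases "c = 0")
    case True
    moreover have "0 \<cdot>\<^sub>v x = 0\<^sub>v n"
      using that by (intro eq_vecI) auto
    ultimately show ?thesis
      using that by simp
  next
    case False
    then show ?thesis
      using that by simp
  qed
  then show ?thesis
    unfolding binary_code_def subspace_def submodule_def
    using vec_vs[of n, where 'a=bit] vec_module[of n, where 'a=bit]
    by (auto simp: module_vec_simps)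
qed

section \<open>Dual codes, linear functionals and the direct sum decomposition\<close>

lemma mem_dual_code_iff:
  "x \<in> dual_code n C \<longleftrightarrow> x \<in> carrier_vec n \<and> (\<forall>y\<in>C. x \<bullet> y = 0)"
  unfolding vec_module.orthogonal_complement_def by simp

lemma binary_code_dual_code:
  assumes "C \<subseteq> carrier_vec n"
  shows "binary_code n (dual_code n C)"
  unfolding binary_code_iff
  using assms by (auto simp: mem_dual_code_iff add_scalar_prod_distrib[where n = n] subset_iff)

text \<open>Over the two-element field additivity already gives linearity, so \<open>f\<close> is
  determined by its values on unit vectors.\<close>

lemma additive_bit_eq_scalar_prod:
  fixes f :: "bit vec \<Rightarrow> bit"
  assumes add: "\<And>x y. x \<in> carrier_vec n \<Longrightarrow> y \<in> carrier_vec n \<Longrightarrow> f (x + y) = f x + f y"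
    and v: "v \<in> carrier_vec n"
  shows "f v = v \<bullet> vec n (\<lambda>i. f (unit_vec n i))"
proof -
  \<comment> \<open>\<open>p k\<close> keeps the first \<open>k\<close> coordinates of
    \<open>v\<close> and replaces the others by 0. Building \<open>v\<close> up through these
    truncations adds at most one unit vector at each step.\<close>
  define p where "p k = vec n (\<lambda>i. if i < k then v $ i else 0)" for k
  have zero: "f (0\<^sub>v n) = 0"
    using add[of "0\<^sub>v n" "0\<^sub>v n"] by simp
  have "k \<le> n \<Longrightarrow> f (p k) = (\<Sum>i<k. v $ i * f (unit_vec n i))" for k
  proof (induction k)
    case 0
    have "p 0 = 0\<^sub>v n"
      by (auto simp: p_def)
    then show ?case
      by (simp add: zero)
  next
    case (Suc k)
    show ?case
    proof (cases "v $ k = 0")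
      case True
      then have "p (Suc k) = p k"
        by (auto simp: p_def less_Suc_eq)
      then show ?thesis
        using Suc True by simp
    next
      case False
      then have "p (Suc k) = p k + unit_vec n k"
        using Suc.prems by (intro eq_vecI) (auto simp: p_def less_Suc_eq unit_vec_def)
      moreover have "p k \<in> carrier_vec n"
        by (simp add: p_def)
      ultimately show ?thesis
        using Suc False by (simp add: add)
    qed
  qed
  moreover have "p n = v"
    using v by (auto simp: p_def)
  ultimately show ?thesis
    by (auto simp: scalar_prod_def lessThan_atLeast0)
qed

text \<open>
  A maximal code containing \<open>D\<close> but not \<open>x\<close> has index 2, hence its complement is the indicator of a
  linear functional.
\<close>

lemma code_separation:
  assumes D: "binary_code n D" and x: "x \<in> carrier_vec n" "x \<notin> D"
  obtains w where "w \<in> dual_code n D" "x \<bullet> w \<noteq> 0"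
proof -
  define S where "S = {E. binary_code n E \<and> D \<subseteq> E \<and> x \<notin> E}"
  have "finite S"
    by (rule finite_subset[of _ "Pow (carrier_vec n)"])
      (auto simp: S_def binary_code_iff finite_carrier_vec_bit)
  moreover have "S \<noteq> {}"
    using D x by (auto simp: S_def)
  ultimately have "\<exists>E\<in>S. \<forall>F\<in>S. E \<subseteq> F \<longrightarrow> E = F"
    by (rule finite_has_maximal)
  then obtain E where "E \<in> S" and max: "\<forall>F\<in>S. E \<subseteq> F \<longrightarrow> E = F"
    by (elim bexE)
  then have E: "binary_code n E" and DE: "D \<subseteq> E" and xE: "x \<notin> E"
    by (auto simp: S_def)
  have Ec: "E \<subseteq> carrier_vec n" and E0: "0\<^sub>v n \<in> E"
    and Eadd: "\<And>a b. a \<in> E \<Longrightarrow> b \<in> E \<Longrightarrow> a + b \<in> E"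
    using E by (auto simp: binary_code_iff)
  note cancel = add_cancel_bit_vec[where n = n]
  \<comment> \<open>The set \<open>?F\<close> below is the span of \<open>E\<close> and
    \<open>y\<close>. It is a code strictly larger than \<open>E\<close>, so by maximality it
    contains \<open>x\<close>; as \<open>x\<close> is not in \<open>E\<close>, it has the form
    \<open>e + y\<close>, and adding \<open>y\<close> leaves \<open>e\<close>.\<close>
  have index2: "x + y \<in> E" if y: "y \<in> carrier_vec n" "y \<notin> E" for y
  proof -
    let ?F = "E \<union> (\<lambda>e. e + y) ` E"
    have "a + b \<in> ?F" if ab: "a \<in> ?F" "b \<in> ?F" for a b
    proof -
      have *: "(e + y) + g = (e + g) + y" "e + (g + y) = (e + g) + y" "(e + y) + (g + y) = e + g"
        if "e \<in> E" "g \<in> E" for e g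
      proof -
        have eg: "e \<in> carrier_vec n" "g \<in> carrier_vec n"
          using that Ec by auto
        show "(e + y) + g = (e + g) + y" "(e + y) + (g + y) = e + g"
          using eg y add_exchange_vec[of e n y g "0\<^sub>v n"] add_exchange_vec[of e n y g y]
          by (simp_all add: add_self_bit_vec)
        show "e + (g + y) = (e + g) + y"
          using eg y by (simp add: assoc_add_vec[where n = n])
      qed
      have "E \<subseteq> ?F" "\<And>e. e \<in> E \<Longrightarrow> e + y \<in> ?F"
        by auto
      then show ?thesis
        using ab * Eadd by (elim UnE imageE) auto
    qed
    then have "binary_code n ?F"
      using Ec E0 y unfolding binary_code_iff by auto
    moreover have "y \<in> ?F"
      using E0 y by (force intro!: image_eqI[of _ _ "0\<^sub>v n"])
    ultimately have "x \<in> ?F"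
      using max y DE by (auto simp: S_def)
    then obtain e where "e \<in> E" "x = e + y"
      using xE by auto
    then show ?thesis
      using Ec y cancel by auto
  qed
  define f :: "bit vec \<Rightarrow> bit" where "f y = (if y \<in> E then 0 else 1)" for y
  define w where "w = vec n (\<lambda>i. f (unit_vec n i))"
  have "f (a + b) = f a + f b" if ab: "a \<in> carrier_vec n" "b \<in> carrier_vec n" for a b
  proof -
    have 1: "a + b \<notin> E" if "a \<in> E" "b \<notin> E"
      using that Eadd[of a "a + b"] cancel ab by auto
    have 2: "a + b \<notin> E" if "a \<notin> E" "b \<in> E"
      using that Eadd[of "a + b" b] cancel ab by auto
    \<comment> \<open>By \<open>index2\<close>, both \<open>x + a\<close> and \<open>x + b\<close>
      lie in \<open>E\<close>; in their sum the two copies of \<open>x\<close> cancel.\<close>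
    have 3: "a + b \<in> E" if "a \<notin> E" "b \<notin> E"
    proof -
      have "(x + a) + (x + b) \<in> E"
        using that ab index2 Eadd by blast
      moreover have "(x + a) + (x + b) = a + b"
        using x ab add_exchange_vec[of x n a x b] by (simp add: add_self_bit_vec)
      ultimately show ?thesis
        by simp
    qed
    show ?thesis
      using 1 2 3 Eadd by (auto simp: f_def)
  qed
  then have f: "f y = y \<bullet> w" if "y \<in> carrier_vec n" for y
    unfolding w_def using additive_bit_eq_scalar_prod that by blast
  have w: "w \<in> carrier_vec n"
    by (simp add: w_def)
  have "w \<bullet> y = 0" if "y \<in> D" for y
  proof -
    have y: "y \<in> E" "y \<in> carrier_vec n"
      using that DE Ec by auto
    then show ?thesis
      using f[of y] comm_scalar_prod[OF w y(2)] by (simp add: f_def)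
  qed
  then have "w \<in> dual_code n D"
    using w by (simp add: mem_dual_code_iff)
  moreover have "x \<bullet> w \<noteq> 0"
    using f[of x] x xE by (simp add: f_def)
  ultimately show thesis
    by (rule that)
qed

text \<open>If the sum \<open>D\<close> of \<open>C\<close> and its dual missed \<open>x\<close>, a
  vector \<open>w\<close> orthogonal to \<open>D\<close> would satisfy
  \<open>x \<bullet> w \<noteq> 0\<close>. Such a \<open>w\<close> is orthogonal to \<open>C\<close>
  and to the dual of \<open>C\<close>; by biduality it lies in \<open>C\<close> as well as in the
  dual, hence is zero, a contradiction.\<close>

lemma LCD_code_decomposition:
  assumes "LCD_code n C" and x: "x \<in> carrier_vec n"
  obtains c d where "c \<in> C" "d \<in> dual_code n C" "x = c + d"
proof -
  have C: "binary_code n C" and int: "C \<inter> dual_code n C = {0\<^sub>v n}"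
    using assms by (auto simp: LCD_code_def)
  then have Cc: "C \<subseteq> carrier_vec n"
    by (simp add: binary_code_iff)
  have C': "binary_code n (dual_code n C)"
    using Cc by (rule binary_code_dual_code)
  define D where "D = {c + d | c d. c \<in> C \<and> d \<in> dual_code n C}"
  have "a + b \<in> D" if ab: "a \<in> D" "b \<in> D" for a b
  proof -
    obtain c d c' d' where *: "c \<in> C" "d \<in> dual_code n C" "a = c + d"
        "c' \<in> C" "d' \<in> dual_code n C" "b = c' + d'"
      using ab by (auto simp: D_def)
    then have "{c, c', d, d'} \<subseteq> carrier_vec n"
      using Cc by (auto simp: mem_dual_code_iff)
    then have "a + b = (c + c') + (d + d')"
      using * add_exchange_vec[of c n d c' d'] by simp
    then show ?thesis
      using * C C' unfolding D_def binary_code_iff by blast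
  qed
  moreover have CD: "C \<subseteq> D" "dual_code n C \<subseteq> D"
  proof -
    have "c + 0\<^sub>v n \<in> D" if "c \<in> C" for c
      using that C' unfolding D_def binary_code_iff by blast
    then show "C \<subseteq> D"
      using Cc by (auto simp: subset_iff)
    have "0\<^sub>v n + d \<in> D" if "d \<in> dual_code n C" for d
      using that C unfolding D_def binary_code_iff by blast
    then show "dual_code n C \<subseteq> D"
      by (auto simp: mem_dual_code_iff)
  qed
  moreover have "D \<subseteq> carrier_vec n"
    using Cc by (auto simp: D_def mem_dual_code_iff)
  ultimately have D: "binary_code n D"
    using C by (auto simp: binary_code_iff)
  have "x \<in> D"
  proof (rule ccontr)
    assume "x \<notin> D"
    then obtain w where w: "w \<in> dual_code n D" "x \<bullet> w \<noteq> 0"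
      using code_separation[OF D x] by blast
    then have wc: "w \<in> carrier_vec n" and wD: "\<forall>y\<in>D. w \<bullet> y = 0"
      by (auto simp: mem_dual_code_iff)
    \<comment> \<open>This is biduality: otherwise separation from \<open>C\<close> gives a dual
      vector \<open>u\<close> not orthogonal to \<open>w\<close>, although \<open>u\<close> belongs
      to \<open>D\<close>.\<close>
    have "w \<in> C"
    proof (rule ccontr)
      assume "w \<notin> C"
      then obtain u where "u \<in> dual_code n C" "w \<bullet> u \<noteq> 0"
        using code_separation[OF C wc] by blast
      then show False
        using wD CD by auto
    qed
    moreover have "w \<in> dual_code n C"
      using wc wD CD by (auto simp: mem_dual_code_iff)
    ultimately have "w = 0\<^sub>v n"
      using int by auto
    then show False
      using w x by simp
  qed
  then show thesis
    using that by (auto simp: D_def)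
qed

section \<open>Orthogonal projectors\<close>

lemma row_vec_mult_eq_transpose_mult_mat_vec:
  fixes P :: "'a::comm_semiring_0 mat"
  assumes "x \<in> carrier_vec n" "P \<in> carrier_mat n m"
  shows "x \<^sub>v* P = transpose_mat P *\<^sub>v x"
  using assms unfolding row_vec_mult_def
  by (intro eq_vecI) (auto intro: comm_scalar_prod)

lemma eq_mat_if_row_vec_mult_eq:
  fixes P Q :: "'a::semiring_1 mat"
  assumes "P \<in> carrier_mat n m" "Q \<in> carrier_mat n m"
    and "\<And>x. x \<in> carrier_vec n \<Longrightarrow> x \<^sub>v* P = x \<^sub>v* Q"
  shows "P = Q"
proof (rule eq_matI)
  fix i j
  assume "i < dim_row Q" "j < dim_col Q"
  then have ij: "i < n" "j < m"
    using assms by auto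
  have "(unit_vec n i \<^sub>v* P) $ j = (unit_vec n i \<^sub>v* Q) $ j"
    using assms(3)[of "unit_vec n i"] by simp
  then show "P $$ (i, j) = Q $$ (i, j)"
    using ij assms(1,2) by (simp add: row_vec_mult_def scalar_prod_left_unit[where n = n])
qed (use assms in auto)

lemma row_vec_mult_add:
  fixes P :: "'a::semiring_0 mat"
  assumes "x \<in> carrier_vec n" "y \<in> carrier_vec n" "P \<in> carrier_mat n m"
  shows "(x + y) \<^sub>v* P = x \<^sub>v* P + y \<^sub>v* P"
  using assms unfolding row_vec_mult_def
  by (intro eq_vecI) (auto simp: add_scalar_prod_distrib[where n = n])

lemma is_orthogonal_projector_apply:
  assumes "LCD_code n C" "is_orthogonal_projector n C P" "c \<in> C" "d \<in> dual_code n C"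
  shows "(c + d) \<^sub>v* P = c"
proof -
  have cd: "c \<in> carrier_vec n" "d \<in> carrier_vec n"
    using assms by (auto simp: LCD_code_def binary_code_iff mem_dual_code_iff)
  moreover have "P \<in> carrier_mat n n" "c \<^sub>v* P = c" "d \<^sub>v* P = 0\<^sub>v n"
    using assms by (auto simp: is_orthogonal_projector_def)
  ultimately show ?thesis
    by (simp add: row_vec_mult_add[where n = n and m = n])
qed

text \<open>The defining conditions fix the value on \<open>C\<close> and on its dual, and these two
  together span the space.\<close>

lemma is_orthogonal_projector_unique:
  assumes "LCD_code n C" "is_orthogonal_projector n C P" "is_orthogonal_projector n C Q"
  shows "P = Q"
proof (rule eq_mat_if_row_vec_mult_eq)
  show "P \<in> carrier_mat n n" "Q \<in> carrier_mat n n"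
    using assms by (auto simp: is_orthogonal_projector_def)
next
  fix x :: "bit vec"
  assume "x \<in> carrier_vec n"
  then obtain c d where "c \<in> C" "d \<in> dual_code n C" "x = c + d"
    using LCD_code_decomposition assms(1) by blast
  then show "x \<^sub>v* P = x \<^sub>v* Q"
    using assms is_orthogonal_projector_apply by simp
qed

text \<open>
  If \<open>c i\<close> denotes the component in \<open>C\<close> of the \<open>i\<close>-th unit vector, the projector has entries
  \<open>c i $ j = c i \<bullet> c j\<close>; it is therefore symmetric with both rows and columns \<open>c i\<close>.
\<close>

lemma ex_orthogonal_projector:
  assumes LCD: "LCD_code n C"
  shows "\<exists>P. is_orthogonal_projector n C P"
proof -
  have Cc: "C \<subseteq> carrier_vec n"
    using LCD by (simp add: LCD_code_def binary_code_iff)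
  \<comment> \<open>No bound on \<open>i\<close> is imposed: for \<open>i \<ge> n\<close> the unit
    vector is still in the carrier, so \<open>c\<close> and \<open>d\<close> can be chosen as total
    functions.\<close>
  have "\<exists>c d. c \<in> C \<and> d \<in> dual_code n C \<and> unit_vec n i = c + d" for i
    by (rule LCD_code_decomposition[OF LCD unit_vec_carrier[of n i]]) blast
  then have "\<exists>c d. \<forall>i. c i \<in> C \<and> d i \<in> dual_code n C \<and> unit_vec n i = c i + d i"
    by (subst choice_iff[symmetric])+ blast
  then obtain c d where c: "\<And>i. c i \<in> C" and d: "\<And>i. d i \<in> dual_code n C"
    and cd: "\<And>i. unit_vec n i = c i + d i"
    by blast
  have cc: "c i \<in> carrier_vec n" and dc: "d i \<in> carrier_vec n" for i
    using c Cc d by (auto simp: mem_dual_code_iff)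
  have orth: "x \<bullet> d i = 0" if "x \<in> C" for x i
    using d[of i] dc[of i] that Cc comm_scalar_prod[of x n "d i"] by (auto simp: mem_dual_code_iff)
  \<comment> \<open>Since \<open>d i\<close> is orthogonal to \<open>C\<close>, pairing a codeword
    with \<open>c i\<close> is the same as pairing it with the unit vector, which reads off
    coordinate \<open>i\<close>.\<close>
  have unit: "x \<bullet> c i = x $ i" if "x \<in> C" "i < n" for x i
  proof -
    have "x $ i = x \<bullet> (c i + d i)"
      using that Cc by (simp add: cd[symmetric] scalar_prod_right_unit[where n = n])
    also have "\<dots> = x \<bullet> c i"
      using that Cc cc dc orth by (simp add: scalar_prod_add_distrib[where n = n] subset_iff)
    finally show ?thesis
      by simp
  qed
  have sym: "c i $ j = c j $ i" if "i < n" "j < n" for i j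
    using unit[OF c that(2), of i] unit[OF c that(1), of j] comm_scalar_prod[OF cc cc, of i j] by simp
  define P where "P = mat n n (\<lambda>(i, j). c i $ j)"
  have col: "col P j = c j" if "j < n" for j
    using that cc[of j] by (intro eq_vecI) (auto simp: P_def sym)
  have mult: "x \<^sub>v* P = vec n (\<lambda>j. x \<bullet> c j)" for x
    unfolding row_vec_mult_def using col by (intro eq_vecI) (auto simp: P_def)
  have "x \<^sub>v* P = x" if "x \<in> C" for x
    using that Cc by (intro eq_vecI) (auto simp: mult unit)
  moreover have "x \<^sub>v* P = 0\<^sub>v n" if "x \<in> dual_code n C" for x
    using that c by (intro eq_vecI) (auto simp: mult mem_dual_code_iff)
  moreover have "P \<in> carrier_mat n n"
    by (simp add: P_def)
  ultimately show ?thesis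
    by (auto simp: is_orthogonal_projector_def)
qed

text \<open>Existence and uniqueness make the definite description proper, so that later arguments
  can use the characterising predicate instead.\<close>

lemma eq_orthogonal_projector_iff:
  assumes "LCD_code n C"
  shows "P = orthogonal_projector n C \<longleftrightarrow> is_orthogonal_projector n C P"
proof -
  have ex1: "\<exists>!P. is_orthogonal_projector n C P"
    using ex_orthogonal_projector[OF assms] is_orthogonal_projector_unique[OF assms] by blast
  show ?thesis
    unfolding orthogonal_projector_def
    using theI'[OF ex1] the1_equality[OF ex1] by metis
qed

section \<open>Idempotence of projectors and its converse for symmetric matrices\<close>

lemma row_vec_mult_mat_mult:
  fixes P Q :: "'a::semiring_0 mat"
  assumes "x \<in> carrier_vec n" "P \<in> carrier_mat n m" "Q \<in> carrier_mat m l"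
  shows "x \<^sub>v* (P * Q) = (x \<^sub>v* P) \<^sub>v* Q"
proof (rule eq_vecI)
  fix j
  assume "j < dim_vec ((x \<^sub>v* P) \<^sub>v* Q)"
  then have j: "j < l"
    using assms by (simp add: row_vec_mult_def)
  then have "(x \<^sub>v* (P * Q)) $ j = x \<bullet> (P *\<^sub>v col Q j)"
    using assms by (simp add: row_vec_mult_def mult_mat_vec_def)
  also have "\<dots> = vec m (\<lambda>j. x \<bullet> col P j) \<bullet> col Q j"
    using assms j assoc_scalar_prod[of x n P m "col Q j"] by (simp add: mult_mat_vec_def)
  finally show "(x \<^sub>v* (P * Q)) $ j = ((x \<^sub>v* P) \<^sub>v* Q) $ j"
    using assms j by (simp add: row_vec_mult_def)
qed (use assms in \<open>auto simp: row_vec_mult_def\<close>)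

text \<open>The first application sends \<open>c + d\<close> to \<open>c\<close>, and the second
  fixes \<open>c\<close> because it is a codeword. By the decomposition this covers every
  vector.\<close>

lemma is_orthogonal_projector_idempotent:
  assumes LCD: "LCD_code n C" and P: "is_orthogonal_projector n C P"
  shows "P * P = P"
proof (rule eq_mat_if_row_vec_mult_eq)
  have Pc: "P \<in> carrier_mat n n"
    using P by (simp add: is_orthogonal_projector_def)
  then show "P * P \<in> carrier_mat n n" "P \<in> carrier_mat n n"
    by auto
  fix x :: "bit vec"
  assume x: "x \<in> carrier_vec n"
  then obtain c d where cd: "c \<in> C" "d \<in> dual_code n C" "x = c + d"
    using LCD_code_decomposition LCD by blast
  then have "x \<^sub>v* P = c"
    using is_orthogonal_projector_apply LCD P by simp
  moreover have "c \<^sub>v* P = c"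
    using P cd by (simp add: is_orthogonal_projector_def)
  ultimately show "x \<^sub>v* (P * P) = x \<^sub>v* P"
    using x Pc row_vec_mult_mat_mult[of x n P n P n] by simp
qed

text \<open>Even weight thereby becomes orthogonality to the all-one vector.\<close>

lemma of_nat_hamming_weight:
  assumes "x \<in> carrier_vec n"
  shows "of_nat (hamming_weight x) = x \<bullet> vec n (\<lambda>_. 1)"
proof -
  have "hamming_weight x = card {i \<in> {0..<n}. x $ i \<noteq> 0}"
    using assms by (simp add: hamming_weight_def)
  then have "of_nat (hamming_weight x) = (\<Sum>i \<in> {i \<in> {0..<n}. x $ i \<noteq> 0}. 1 :: bit)"
    by (simp only: of_nat_sum card_eq_sum of_nat_1)
  also have "\<dots> = (\<Sum>i = 0..<n. if x $ i \<noteq> 0 then 1 else 0)"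
    by (rule sum.inter_filter) simp
  also have "\<dots> = x \<bullet> vec n (\<lambda>_. 1)"
    unfolding scalar_prod_def by (rule sum.cong) auto
  finally show ?thesis .
qed

text \<open>Idempotence makes the fixed space \<open>C\<close> equal to the image of
  \<open>A\<close>, and symmetry makes \<open>A\<close> self-adjoint; hence \<open>A\<close> kills
  everything orthogonal to its image. The zero diagonal serves to show that \<open>A\<close> kills
  the all-one vector, which gives evenness.\<close>

lemma symmetric_idempotent_is_orthogonal_projector:
  fixes A :: "bit mat"
  assumes A: "A \<in> carrier_mat n n" and sym: "transpose_mat A = A"
    and idem: "A * A = A" and diag: "\<And>i. i < n \<Longrightarrow> A $$ (i, i) = 0"
  defines "C \<equiv> {x \<in> carrier_vec n. A *\<^sub>v x = x}"
  shows "LCD_code n C" "even_code C" "is_orthogonal_projector n C A"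
proof -
  have adj: "(A *\<^sub>v x) \<bullet> y = x \<bullet> (A *\<^sub>v y)" if "x \<in> carrier_vec n" "y \<in> carrier_vec n" for x y
    using transpose_vec_mult_scalar[OF A that(2,1)] sym by simp
  have rvm: "x \<^sub>v* A = A *\<^sub>v x" if "x \<in> carrier_vec n" for x
    using row_vec_mult_eq_transpose_mult_mat_vec[OF that A] sym by simp
  have AC: "A *\<^sub>v x \<in> C" if "x \<in> carrier_vec n" for x
    using A that idem assoc_mult_mat_vec[OF A A that] by (simp add: C_def)
  have code: "binary_code n C"
    using A mult_add_distrib_mat_vec[OF A]
    by (auto simp: binary_code_iff C_def intro!: eq_vecI)
  \<comment> \<open>Each coordinate of \<open>A *\<^sub>v x\<close> is a product with a unit vector;
    self-adjointness moves \<open>A\<close> onto that unit vector, whose image is a codeword and so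
    is orthogonal to \<open>x\<close>.\<close>
  have dual: "A *\<^sub>v x = 0\<^sub>v n" if x: "x \<in> dual_code n C" for x
  proof (rule eq_vecI)
    fix i
    assume "i < dim_vec (0\<^sub>v n)"
    then have i: "i < n"
      by simp
    have xc: "x \<in> carrier_vec n"
      using x by (simp add: mem_dual_code_iff)
    have "(A *\<^sub>v x) $ i = (A *\<^sub>v x) \<bullet> unit_vec n i"
      by (rule scalar_prod_right_unit[OF i, symmetric])
    also have "\<dots> = x \<bullet> (A *\<^sub>v unit_vec n i)"
      by (rule adj) (use xc in auto)
    also have "\<dots> = 0"
      using x AC[of "unit_vec n i"] by (simp add: mem_dual_code_iff)
    finally show "(A *\<^sub>v x) $ i = 0\<^sub>v n $ i"
      using i by simp
  qed (use A in auto)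
  have "x = 0\<^sub>v n" if "x \<in> C" "x \<in> dual_code n C" for x
    using dual[OF that(2)] that(1) by (simp add: C_def)
  moreover have "0\<^sub>v n \<in> C" "0\<^sub>v n \<in> dual_code n C"
    using code binary_code_dual_code[of C n] by (auto simp: binary_code_iff)
  ultimately have "C \<inter> dual_code n C = {0\<^sub>v n}"
    by blast
  then show "LCD_code n C"
    using code by (simp add: LCD_code_def)
  show "is_orthogonal_projector n C A"
    unfolding is_orthogonal_projector_def
  proof (intro conjI ballI)
    show "x \<^sub>v* A = x" if "x \<in> C" for x
      using that rvm by (simp add: C_def)
    show "x \<^sub>v* A = 0\<^sub>v n" if "x \<in> dual_code n C" for x
      using dual[OF that] rvm[of x] that by (simp add: mem_dual_code_iff)
  qed (rule A)
  let ?one = "vec n (\<lambda>_. 1) :: bit vec"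
  have "A *\<^sub>v ?one = 0\<^sub>v n"
  proof (rule eq_vecI)
    fix i
    assume "i < dim_vec (0\<^sub>v n)"
    then have i: "i < n"
      by simp
    have symi: "A $$ (j, i) = A $$ (i, j)" if "j < n" for j
    proof -
      have "A $$ (j, i) = transpose_mat A $$ (i, j)"
        using A i that by simp
      then show ?thesis
        by (simp only: sym)
    qed
    have "(A *\<^sub>v ?one) $ i = (\<Sum>j = 0..<n. A $$ (i, j))"
      using A i by (simp add: scalar_prod_def del: mult_bit_eq_and)
    \<comment> \<open>Every element of the two-element field equals its own square, so by symmetry
      each entry of the row may be replaced by this product. The row sum thus becomes a diagonal
      entry of \<open>A * A\<close>.\<close>
    also have "\<dots> = (\<Sum>j = 0..<n. A $$ (i, j) * A $$ (j, i))"
      by (rule sum.cong) (simp_all add: symi)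
    also have "\<dots> = (A * A) $$ (i, i)"
      using A i by (simp add: scalar_prod_def del: mult_bit_eq_and)
    also have "\<dots> = 0"
      using idem diag i by simp
    finally show "(A *\<^sub>v ?one) $ i = 0\<^sub>v n $ i"
      using i by simp
  qed (use A in auto)
  \<comment> \<open>A codeword satisfies \<open>x = A *\<^sub>v x\<close>, and self-adjointness
    moves \<open>A\<close> onto the all-one vector, which it kills.\<close>
  then have "x \<bullet> ?one = 0" if "x \<in> C" for x
    using adj[of x ?one] that by (simp add: C_def)
  then show "even_code C"
    unfolding even_code_def
    by (metis (no_types, lifting) C_def mem_Collect_eq of_nat_bit_eq_0_iff of_nat_hamming_weight)
qed

section \<open>Adjacency matrices\<close>

lemma (in sym_digraph) dominates_sym: "u \<rightarrow>\<^bsub>G\<^esub> v \<longleftrightarrow> v \<rightarrow>\<^bsub>G\<^esub> u"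
  using sym_arcs by (auto simp: symmetric_def dest: symD)

text \<open>Regarding the degree as the number of common neighbours of \<open>x\<close> with itself
  lets diagonal and off-diagonal entries of the squared adjacency matrix be treated alike. Without
  parallel arcs, an out-arc is determined by its head.\<close>

lemma (in nomulti_digraph) out_degree_eq_card_common_neighbours:
  "out_degree G x = card (common_neighbours G x x)"
proof -
  have "bij_betw (head G) (out_arcs G x) (common_neighbours G x x)"
    unfolding bij_betw_def
  proof
    show "inj_on (head G) (out_arcs G x)"
      by (rule inj_onI) (auto intro!: no_multi_arcs simp: arc_to_ends_def)
    show "head G ` out_arcs G x = common_neighbours G x x"
      by (force simp: common_neighbours_def arcs_ends_def arc_to_ends_def)
  qed
  then show ?thesis
    unfolding out_degree_def by (rule bij_betw_same_card)
qed

text \<open>The matrix product counts walks of length two from \<open>vs ! i\<close> to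
  \<open>vs ! j\<close>; by symmetry of adjacency, their midpoints are the common neighbours. The
  enumeration \<open>vs\<close> reindexes the sum over positions as one over vertices.\<close>

lemma (in graph) adjacency_matrix_square_entry:
  assumes "distinct vs" "set vs = verts G" "i < length vs" "j < length vs"
  shows "(adjacency_matrix G vs * adjacency_matrix G vs :: 'c::semiring_1 mat) $$ (i, j)
    = of_nat (card (common_neighbours G (vs ! i) (vs ! j)))"
proof -
  let ?g = "\<lambda>z. if vs ! i \<rightarrow>\<^bsub>G\<^esub> z \<and> vs ! j \<rightarrow>\<^bsub>G\<^esub> z then 1 else (0 :: 'c)"
  have bij: "bij_betw ((!) vs) {0..<length vs} (verts G)"
    using bij_betw_nth[OF assms(1), of "{0..<length vs}" "verts G"] assms(2)
    by (simp add: lessThan_atLeast0)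
  have "(adjacency_matrix G vs * adjacency_matrix G vs :: 'c mat) $$ (i, j)
      = (\<Sum>t = 0..<length vs. ?g (vs ! t))"
    using assms unfolding adjacency_matrix_def
    by (simp add: scalar_prod_def) (auto intro!: sum.cong simp: dominates_sym)
  also have "\<dots> = (\<Sum>z\<in>verts G. ?g z)"
    by (rule sum.reindex_bij_betw[OF bij])
  also have "\<dots> = (\<Sum>z \<in> verts G \<inter> {z. vs ! i \<rightarrow>\<^bsub>G\<^esub> z \<and> vs ! j \<rightarrow>\<^bsub>G\<^esub> z}. 1)"
    by (subst sum.inter_restrict) auto
  also have "verts G \<inter> {z. vs ! i \<rightarrow>\<^bsub>G\<^esub> z \<and> vs ! j \<rightarrow>\<^bsub>G\<^esub> z} = common_neighbours G (vs ! i) (vs ! j)"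
    by (auto simp: common_neighbours_def)
  finally show ?thesis
    by simp
qed

text \<open>Symmetry and zero diagonal hold for the adjacency matrix of any simple graph, so
  idempotence is the only condition left.\<close>

lemma (in graph) yields_even_LCD_code_iff_idempotent:
  assumes "distinct vs" "set vs = verts G"
  shows "yields_even_LCD_code G vs \<longleftrightarrow>
    (adjacency_matrix G vs * adjacency_matrix G vs :: bit mat) = adjacency_matrix G vs"
    (is "_ \<longleftrightarrow> ?A * ?A = ?A")
proof
  assume "yields_even_LCD_code G vs"
  then show "?A * ?A = ?A"
    unfolding yields_even_LCD_code_def
    using eq_orthogonal_projector_iff is_orthogonal_projector_idempotent by metis
next
  assume idem: "?A * ?A = ?A"
  have A: "?A \<in> carrier_mat (length vs) (length vs)"
    by (simp add: adjacency_matrix_def)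
  have sym: "transpose_mat ?A = ?A"
    by (rule eq_matI) (auto simp: adjacency_matrix_def dominates_sym)
  have diag: "?A $$ (i, i) = 0" if "i < length vs" for i
    using that adj_not_same by (auto simp: adjacency_matrix_def)
  show "yields_even_LCD_code G vs"
    unfolding yields_even_LCD_code_def
    using symmetric_idempotent_is_orthogonal_projector[OF A sym idem diag]
      eq_orthogonal_projector_iff by blast
qed

section \<open>Parity conditions for strongly regular graphs\<close>

theorem theorem4p2:
  fixes G :: "('a, 'b) pre_digraph" and vs :: "'a list" and v k l m :: nat
  assumes "strongly_regular_graph G v k l m"
    and "distinct vs" and "set vs = verts G"
  shows "yields_even_LCD_code G vs \<longleftrightarrow>
    [k = 0] (mod 2) \<and> [l = 1] (mod 2) \<and> [m = 0] (mod 2)"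
proof -
  let ?n = "length vs"
  let ?A = "adjacency_matrix G vs :: bit mat"
  interpret graph G
    using assms(1) by (simp add: strongly_regular_graph_def)
  have k: "card (common_neighbours G x x) = k" if "x \<in> verts G" for x
    using assms(1) that by (simp add: strongly_regular_graph_def out_degree_eq_card_common_neighbours)
  have l: "card (common_neighbours G x y) = l" if "x \<rightarrow>\<^bsub>G\<^esub> y" for x y
    using assms(1) that adj_in_verts[OF that] by (simp add: strongly_regular_graph_def)
  have m: "card (common_neighbours G x y) = m"
    if "x \<in> verts G" "y \<in> verts G" "x \<noteq> y" "\<not> x \<rightarrow>\<^bsub>G\<^esub> y" for x y
    using assms(1) that by (simp add: strongly_regular_graph_def)
  have "?A * ?A = ?A \<longleftrightarrow> (\<forall>i<?n. \<forall>j<?n. (?A * ?A) $$ (i, j) = ?A $$ (i, j))"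
    by (auto simp: mat_eq_iff adjacency_matrix_def)
  \<comment> \<open>Both entries are bits, so they agree exactly when they vanish simultaneously:
    the left one for an even count, the right one for non-adjacency.\<close>
  also have "\<dots> \<longleftrightarrow> (\<forall>i<?n. \<forall>j<?n. even (card (common_neighbours G (vs ! i) (vs ! j)))
      \<longleftrightarrow> \<not> vs ! i \<rightarrow>\<^bsub>G\<^esub> vs ! j)"
  proof -
    have "(?A * ?A) $$ (i, j) = ?A $$ (i, j) \<longleftrightarrow>
        (even (card (common_neighbours G (vs ! i) (vs ! j))) \<longleftrightarrow> \<not> vs ! i \<rightarrow>\<^bsub>G\<^esub> vs ! j)"
      if "i < ?n" "j < ?n" for i j
    proof -
      have "?A $$ (i, j) = (if vs ! i \<rightarrow>\<^bsub>G\<^esub> vs ! j then 1 else 0)"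
        using that by (simp add: adjacency_matrix_def)
      then show ?thesis
        unfolding adjacency_matrix_square_entry[OF assms(2,3) that]
        by (simp flip: of_nat_bit_eq_0_iff)
    qed
    then show ?thesis
      by blast
  qed
  also have "\<dots> \<longleftrightarrow> (\<forall>x \<in> verts G. \<forall>y \<in> verts G.
      even (card (common_neighbours G x y)) \<longleftrightarrow> \<not> x \<rightarrow>\<^bsub>G\<^esub> y)"
    unfolding assms(3)[symmetric] by (metis in_set_conv_nth)
  also have "\<dots> \<longleftrightarrow> even k \<and> odd l \<and> even m"
  proof
    assume *: "\<forall>x \<in> verts G. \<forall>y \<in> verts G.
      even (card (common_neighbours G x y)) \<longleftrightarrow> \<not> x \<rightarrow>\<^bsub>G\<^esub> y"
    \<comment> \<open>An arc supplies both a vertex, needed to read off the parity of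
      \<open>k\<close> on the diagonal, and an adjacent pair, needed for \<open>l\<close>.\<close>
    obtain e where "e \<in> arcs G"
      using assms(1) by (auto simp: strongly_regular_graph_def)
    then have e: "tail G e \<rightarrow>\<^bsub>G\<^esub> head G e" "tail G e \<in> verts G" "head G e \<in> verts G"
      by (auto intro: dominatesI simp: arc_to_ends_def)
    have "even k"
      using * e k adj_not_same by metis
    moreover have "odd l"
      using * e l by metis
    moreover have "even m"
    \<comment> \<open>A complete graph has no distinct non-adjacent pair to test \<open>m\<close>
      on; there the convention \<open>m = 0\<close> gives the parity.\<close>
    proof (cases "complete_graph G")
      case True
      then show ?thesis
        using assms(1) by (simp add: strongly_regular_graph_def)
    next
      case False
      then obtain x y where "x \<in> verts G" "y \<in> verts G" "x \<noteq> y" "\<not> x \<rightarrow>\<^bsub>G\<^esub> y"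
        by (auto simp: complete_graph_def)
      then show ?thesis
        using * m by metis
    qed
    ultimately show "even k \<and> odd l \<and> even m"
      by blast
  next
    assume "even k \<and> odd l \<and> even m"
    then show "\<forall>x \<in> verts G. \<forall>y \<in> verts G.
        even (card (common_neighbours G x y)) \<longleftrightarrow> \<not> x \<rightarrow>\<^bsub>G\<^esub> y"
      \<comment> \<open>The three cases are equal, adjacent, and distinct non-adjacent vertices.
        Equal vertices count as non-adjacent because there are no loops, which matches
        \<open>k\<close> being even.\<close>
      using k l m adj_not_same by metis
  qed
  finally show ?thesis
    using yields_even_LCD_code_iff_idempotent[OF assms(2,3)]
    by (simp add: cong_def even_iff_mod_2_eq_zero odd_iff_mod_2_eq_one)
qed

end
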